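(* Let $N$ be a positive integer and let $f,g\in R=\mathbb{Z}_N[x^{\pm},y^{\pm}]$. The $\mathbf{BB}_N(f,g)$ code is topological if and only if, for every prime $p\mid N$, the $\mathbf{BB}_p(f,g)$ code is topological.
   Context: $\mathbb{Z}_N=\mathbb{Z}/N\mathbb{Z}$; $R=\mathbb{Z}_N[x^{\pm},y^{\pm}]$ is the Laurent polynomial ring in two variables. For $h\in R$, $\bar h(x,y)=h(x^{-1},y^{-1})$. The $\mathbf{BB}_N(f,g)$ code (the $\mathbb{Z}_N$ qudit bivariate-bicycle code specified by $f,g\in R$) is described by the chain complex of $R$-modules $R^2\xrightarrow{\partial}R^4\xrightarrow{\varepsilon}R^2$ with $$\partial=\begin{pmatrix}\bar f&0\\ \bar g&0\\ 0&g\\ 0&-f\end{pmatrix},\qquad \varepsilon=\begin{pmatrix}0&0&f&g\\ -\bar g&\bar f&0&0\end{pmatrix}.$$ The code is called topological if $\ker\varepsilon=\operatorname{im}\partial$; equivalently, if the complex $R\xrightarrow{(g,-f)^T}R^2\xrightarrow{(f\ g)}R$ is exact at $R^2$. For a prime $p\mid N$, the $\mathbf{BB}_p(f,g)$ code is the code defined in the same way over $R_p=\mathbb{Z}_p[x^{\pm},y^{\pm}]\cong R/pR$ by the reductions of $f$ and $g$ modulo $p$. *)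

theory Defs
  imports "HOL-Algebra.IntRing" "HOL-Library.Product_Plus"
begin

text \<open>
  Laurent polynomials in \<open>x, y\<close> over a coefficient ring \<open>K\<close>: the finitely supported function \<open>h\<close>
  stands for the sum of \<open>h (i, j) x\<^sup>i y\<^sup>j\<close> over all integers \<open>i, j\<close>.
\<close>

definition laurent_ring :: "('a, 'm) ring_scheme \<Rightarrow> (int \<times> int \<Rightarrow> 'a) ring" where
  "laurent_ring K =
    \<lparr>carrier = {h. (\<forall>u. h u \<in> carrier K) \<and> finite {u. h u \<noteq> \<zero>\<^bsub>K\<^esub>}},
     mult = (\<lambda>a b w. \<Oplus>\<^bsub>K\<^esub>u \<in> {u. a u \<noteq> \<zero>\<^bsub>K\<^esub>}. a u \<otimes>\<^bsub>K\<^esub> b (w - u)),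
     one = (\<lambda>u. if u = 0 then \<one>\<^bsub>K\<^esub> else \<zero>\<^bsub>K\<^esub>),
     zero = (\<lambda>u. \<zero>\<^bsub>K\<^esub>),
     add = (\<lambda>a b u. a u \<oplus>\<^bsub>K\<^esub> b u)\<rparr>"

definition laurent_bar :: "(int \<times> int \<Rightarrow> 'a) \<Rightarrow> (int \<times> int \<Rightarrow> 'a)" where
  "laurent_bar h = (\<lambda>u. h (- u))"

text \<open>Vectors are lists of entries, matrices are lists of rows.\<close>

definition vectors :: "('a, 'm) ring_scheme \<Rightarrow> nat \<Rightarrow> 'a list set" where
  "vectors S n = {v. length v = n \<and> set v \<subseteq> carrier S}"

definition mat_apply :: "('a, 'm) ring_scheme \<Rightarrow> 'a list list \<Rightarrow> 'a list \<Rightarrow> 'a list" where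
  "mat_apply S A v = map (\<lambda>row. \<Oplus>\<^bsub>S\<^esub>j \<in> {..<length v}. row ! j \<otimes>\<^bsub>S\<^esub> v ! j) A"

definition bb_boundary ::
    "('a, 'm) ring_scheme \<Rightarrow> (int \<times> int \<Rightarrow> 'a) \<Rightarrow> (int \<times> int \<Rightarrow> 'a) \<Rightarrow> (int \<times> int \<Rightarrow> 'a) list list" where
  "bb_boundary K f g = (let R = laurent_ring K in
    [[laurent_bar f, \<zero>\<^bsub>R\<^esub>],
     [laurent_bar g, \<zero>\<^bsub>R\<^esub>],
     [\<zero>\<^bsub>R\<^esub>, g],
     [\<zero>\<^bsub>R\<^esub>, \<ominus>\<^bsub>R\<^esub> f]])"

definition bb_syndrome ::
    "('a, 'm) ring_scheme \<Rightarrow> (int \<times> int \<Rightarrow> 'a) \<Rightarrow> (int \<times> int \<Rightarrow> 'a) \<Rightarrow> (int \<times> int \<Rightarrow> 'a) list list" where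
  "bb_syndrome K f g = (let R = laurent_ring K in
    [[\<zero>\<^bsub>R\<^esub>, \<zero>\<^bsub>R\<^esub>, f, g],
     [\<ominus>\<^bsub>R\<^esub> laurent_bar g, laurent_bar f, \<zero>\<^bsub>R\<^esub>, \<zero>\<^bsub>R\<^esub>]])"

definition bb_topological ::
    "('a, 'm) ring_scheme \<Rightarrow> (int \<times> int \<Rightarrow> 'a) \<Rightarrow> (int \<times> int \<Rightarrow> 'a) \<Rightarrow> bool" where
  "bb_topological K f g \<longleftrightarrow> (let R = laurent_ring K in
    {v \<in> vectors R 4. mat_apply R (bb_syndrome K f g) v = [\<zero>\<^bsub>R\<^esub>, \<zero>\<^bsub>R\<^esub>]}
      = mat_apply R (bb_boundary K f g) ` vectors R 2)"

text \<open>
  Elements of \<open>ZFact N\<close> are cosets of the ideal generated by \<open>N\<close>. For \<open>p\<close> dividing \<open>N\<close>, adding the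
  ideal generated by \<open>p\<close> to such a coset gives its residue class modulo \<open>p\<close>.
\<close>

definition zmod_reduce :: "nat \<Rightarrow> int set \<Rightarrow> int set" where
  "zmod_reduce p C = Idl\<^bsub>\<Z>\<^esub> {int p} <+>\<^bsub>\<Z>\<^esub> C"

lemma zmod_reduce_ZMod:
  assumes "p dvd N"
  shows "zmod_reduce p (ZMod (int N) a) = ZMod (int p) a"
proof -
  have idl: "Idl\<^bsub>\<Z>\<^esub> {k} = range (\<lambda>c. c * k)" for k :: int
    using int.cgenideal_eq_genideal[of k] by (auto simp: cgenideal_def)
  obtain m where m: "int N = m * int p"
    using assms by (metis dvdE mult.commute of_nat_mult)
  show ?thesis
  proof (intro equalityI subsetI)
    fix z assume "z \<in> zmod_reduce p (ZMod (int N) a)"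
    then obtain c d where "z = c * int p + (d * int N + a)"
      unfolding zmod_reduce_def ZMod_def idl set_add_def' a_r_coset_def' by auto
    then have "z = (c + d * m) * int p + a"
      by (simp add: m distrib_right mult.assoc)
    then show "z \<in> ZMod (int p) a"
      unfolding ZMod_def idl a_r_coset_def' by auto
  next
    fix z assume "z \<in> ZMod (int p) a"
    then obtain c where "z = c * int p + (0 * int N + a)"
      unfolding ZMod_def idl a_r_coset_def' by auto
    then show "z \<in> zmod_reduce p (ZMod (int N) a)"
      unfolding zmod_reduce_def ZMod_def idl set_add_def' a_r_coset_def' int_add_eq
      by blast
  qed
qed

definition laurent_reduce :: "nat \<Rightarrow> (int \<times> int \<Rightarrow> int set) \<Rightarrow> (int \<times> int \<Rightarrow> int set)" where
  "laurent_reduce p h = (\<lambda>u. zmod_reduce p (h u))"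

end

theory Submission
  imports Defs "HOL-Library.Poly_Mapping" "HOL-Library.Product_Lexorder"
begin

text \<open>
  All codes are lifted to \<open>S = \<int>[x\<^sup>\<plusminus>, y\<^sup>\<plusminus>]\<close>, where being topological over \<open>\<int>\<^sub>n\<close> means that every pair
  \<open>(a, b)\<close> with \<open>n\<close> dividing \<open>f a + g b\<close> is a multiple of \<open>(g, -f)\<close> modulo \<open>n\<close>, together with the same
  for the conjugates of \<open>f\<close> and \<open>g\<close>. Exactness modulo \<open>p\<close> and modulo \<open>m\<close> gives exactness modulo \<open>p m\<close>
  by lifting a solution modulo \<open>p\<close> and dividing the error by \<open>p\<close>. Conversely, exactness passes
  from \<open>N\<close> to its \<open>p\<close>-part \<open>p\<^sup>k\<close> by a Bezout relation. Exactness modulo \<open>p\<^sup>k\<close> forces \<open>p\<close>, a prime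
  element of \<open>S\<close>, not to divide both \<open>f\<close> and \<open>g\<close>; then \<open>f c \<equiv> g c \<equiv> 0\<close> modulo \<open>p\<^sup>k\<^sup>-\<^sup>1\<close> implies
  \<open>c \<equiv> 0\<close>, so that a factor \<open>p\<^sup>k\<^sup>-\<^sup>1\<close> can be cancelled.
\<close>

section \<open>Exactness modulo an element of an integral domain\<close>

text \<open>This is exactness in the middle of the Koszul complex of \<open>f\<close>,
  \<open>g\<close> over the quotient by \<open>n\<close>, phrased by divisibility so that no
  quotient ring appears. Only one inclusion is stated; the other is automatic, as
  \<open>f * (g * c) + g * (- (f * c)) = 0\<close>.\<close>

definition koszul_exact :: "'a::comm_ring_1 \<Rightarrow> 'a \<Rightarrow> 'a \<Rightarrow> bool" where
  "koszul_exact n f g \<longleftrightarrow>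
    (\<forall>a b. n dvd f * a + g * b \<longrightarrow> (\<exists>c. n dvd a - g * c \<and> n dvd b + f * c))"

lemma koszul_exactD:
  assumes "koszul_exact n f g" and "n dvd f * a + g * b"
  obtains c where "n dvd a - g * c" and "n dvd b + f * c"
  using assms unfolding koszul_exact_def by blast

lemma koszul_exact_swap:
  assumes "koszul_exact n f g"
  shows "koszul_exact n g f"
  unfolding koszul_exact_def
proof (intro allI impI)
  fix a b assume "n dvd g * a + f * b"
  then have "n dvd f * b + g * a"
    by (simp add: add.commute)
  with assms obtain c where "n dvd b - g * c" "n dvd a + f * c"
    by (rule koszul_exactD)
  then have "n dvd a - f * (- c)" "n dvd b + g * (- c)"
    by simp_all
  then show "\<exists>c. n dvd a - f * c \<and> n dvd b + g * c"
    by blast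
qed

lemma koszul_exact_one: "koszul_exact 1 f g"
  by (simp add: koszul_exact_def)

lemma koszul_exact_mult:
  fixes p m :: "'a::idom"
  assumes "p \<noteq> 0" and p: "koszul_exact p f g" and m: "koszul_exact m f g"
  shows "koszul_exact (p * m) f g"
  unfolding koszul_exact_def
proof (intro allI impI)
  fix a b assume ab: "p * m dvd f * a + g * b"
  then have "p dvd f * a + g * b"
    by (rule dvd_mult_left)
  with p obtain c where "p dvd a - g * c" "p dvd b + f * c"
    by (rule koszul_exactD)
  then obtain a' b' where a: "a - g * c = p * a'" and b: "b + f * c = p * b'"
    by (auto elim!: dvdE)
  \<comment> \<open>Subtracting \<open>c\<close> times \<open>(g, -f)\<close> does not change the
    value of \<open>f * a + g * b\<close>, so after cancelling \<open>p\<close> the error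
    \<open>(a', b')\<close> lies in the kernel modulo \<open>m\<close>.\<close>
  have "f * a + g * b = f * (a - g * c) + g * (b + f * c)"
    by (simp add: algebra_simps)
  also have "\<dots> = p * (f * a' + g * b')"
    unfolding a b by (simp add: algebra_simps)
  finally have "m dvd f * a' + g * b'"
    using ab \<open>p \<noteq> 0\<close> by simp
  with m obtain c' where "m dvd a' - g * c'" "m dvd b' + f * c'"
    by (rule koszul_exactD)
  then have "p * m dvd p * (a' - g * c')" "p * m dvd p * (b' + f * c')"
    by simp_all
  moreover have "p * (a' - g * c') = a - g * (c + p * c')"
    using a by (simp add: algebra_simps)
  moreover have "p * (b' + f * c') = b + f * (c + p * c')"
    using b by (simp add: algebra_simps)
  ultimately show "\<exists>c. p * m dvd a - g * c \<and> p * m dvd b + f * c"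
    by metis
qed

text \<open>Scaling by \<open>m\<close> carries a kernel pair modulo \<open>q\<close> to one modulo
  \<open>q * m\<close>. Since \<open>t\<close> inverts \<open>m\<close> modulo \<open>q\<close>, a
  witness \<open>c\<close> for the scaled pair yields the witness \<open>t * c\<close>.\<close>

lemma koszul_exact_coprime_factor:
  fixes q m :: "'a::comm_ring_1"
  assumes "koszul_exact (q * m) f g" and bezout: "s * q + t * m = 1"
  shows "koszul_exact q f g"
  unfolding koszul_exact_def
proof (intro allI impI)
  fix a b assume "q dvd f * a + g * b"
  then have "q * m dvd (f * a + g * b) * m"
    by (rule mult_dvd_mono) simp
  then have "q * m dvd f * (m * a) + g * (m * b)"
    by (simp add: algebra_simps)
  with assms(1) obtain c where "q * m dvd m * a - g * c" "q * m dvd m * b + f * c"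
    by (rule koszul_exactD)
  then have "q dvd m * a - g * c" "q dvd m * b + f * c"
    by (auto dest: dvd_mult_left)
  then have "q dvd q * (s * a) + t * (m * a - g * c)" "q dvd q * (s * b) + t * (m * b + f * c)"
    by simp_all
  moreover have "q * (s * a) + t * (m * a - g * c) = (s * q + t * m) * a - g * (t * c)"
    by (simp add: algebra_simps)
  moreover have "q * (s * b) + t * (m * b + f * c) = (s * q + t * m) * b + f * (t * c)"
    by (simp add: algebra_simps)
  ultimately show "\<exists>c. q dvd a - g * c \<and> q dvd b + f * c"
    using bezout by auto
qed

section \<open>Descent from a prime power to the prime\<close>

lemma prime_elem_power_dvd_multD:
  fixes p :: "'a::idom"
  assumes p: "prime_elem p" and f: "\<not> p dvd f"
  shows "p ^ k dvd f * c \<Longrightarrow> p ^ k dvd c"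
proof (induction k arbitrary: c)
  case (Suc k)
  from Suc.prems have "p dvd f * c"
    by (metis dvd_mult_left power_Suc)
  with p f obtain c' where c': "c = p * c'"
    using prime_elem_dvd_multD by (blast elim: dvdE)
  from Suc.prems have "p * p ^ k dvd p * (f * c')"
    by (simp only: c' power_Suc mult.left_commute)
  with p have "p ^ k dvd f * c'"
    by (simp only: dvd_mult_cancel_left) auto
  then have "p ^ k dvd c'"
    by (rule Suc.IH)
  then show ?case
    by (simp add: c')
qed simp

text \<open>The exponent of \<open>p\<close> in \<open>f\<close> is truncated at \<open>k\<close>,
  so zero and any other element divisible by all powers of \<open>p\<close> fall under the first
  alternative.\<close>

lemma power_dvd_or_exact_power:
  fixes p f :: "'a::comm_ring_1"
  obtains "p ^ k dvd f" | r f' where "r < k" "f = p ^ r * f'" "\<not> p dvd f'"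
proof (induction k arbitrary: thesis)
  case (Suc k)
  show ?case
  proof (rule Suc.IH)
    assume "p ^ k dvd f"
    then obtain f' where f': "f = p ^ k * f'" ..
    show thesis
    proof (cases "p dvd f'")
      case True
      then have "p ^ Suc k dvd f"
        unfolding f' by (auto elim!: dvdE simp: ac_simps)
      then show thesis by (rule Suc.prems)
    next
      case False
      then show thesis using f' Suc.prems(2) by blast
    qed
  qed (use Suc.prems(2) less_SucI in blast)
qed simp

text \<open>
  If \<open>f\<close> is the one of \<open>f\<close>, \<open>g\<close> that is less divisible by \<open>p\<close>, then \<open>p ^ Suc k dvd f * c\<close>
  implies \<open>p ^ Suc k dvd g * c\<close>, so exactness cannot represent the kernel element \<open>(p ^ k, 0)\<close>.
\<close>

lemma koszul_exact_prime_power_not_dvd: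
  fixes p :: "'a::idom"
  assumes p: "prime_elem p" and ex: "koszul_exact (p ^ Suc k) f g"
    and f: "f = p ^ r * f'" "\<not> p dvd f'" "r < Suc k" and g: "p ^ r dvd g"
  shows "\<not> p dvd f"
proof
  assume "p dvd f"
  then have "p ^ Suc k dvd f * p ^ k + g * 0"
    by (simp add: mult_dvd_mono)
  with ex obtain c where c: "p ^ Suc k dvd p ^ k - g * c" "p ^ Suc k dvd 0 + f * c"
    by (rule koszul_exactD)
  \<comment> \<open>Of the \<open>Suc k\<close> factors \<open>p\<close> of \<open>f * c\<close>,
    only \<open>r\<close> come from \<open>f\<close>. The other \<open>j\<close> must come from
    \<open>c\<close>, and \<open>p ^ r dvd g\<close> then completes the full power in
    \<open>g * c\<close>.\<close>
  obtain j where j: "Suc k = r + j"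
    using f(3) by (metis less_imp_add_positive)
  from c(2) have "p ^ r * p ^ j dvd p ^ r * (f' * c)"
    by (simp only: j f(1) power_add add_0 mult.assoc)
  with p have "p ^ j dvd f' * c"
    by simp
  with p f(2) have "p ^ j dvd c"
    by (rule prime_elem_power_dvd_multD)
  with g have "p ^ Suc k dvd g * c"
    by (simp only: j power_add mult_dvd_mono)
  with c(1) have "p ^ Suc k dvd p ^ k - g * c + g * c"
    by (rule dvd_add)
  then have "p ^ k * p dvd p ^ k * 1"
    by (simp only: diff_add_cancel power_Suc2 mult_1_right)
  with p show False
    by (simp only: dvd_mult_cancel_left) (auto simp: prime_elem_def)
qed

text \<open>Scaling by \<open>p ^ k\<close> carries a kernel pair modulo \<open>p\<close> to one
  modulo \<open>p ^ Suc k\<close>. The resulting witness is itself a multiple of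
  \<open>p ^ k\<close>, because \<open>p\<close> does not divide \<open>f\<close>, and this factor
  cancels.\<close>

lemma koszul_exact_prime_powerD_not_dvd:
  fixes p :: "'a::idom"
  assumes p: "prime_elem p" and ex: "koszul_exact (p ^ Suc k) f g" and f: "\<not> p dvd f"
  shows "koszul_exact p f g"
  unfolding koszul_exact_def
proof (intro allI impI)
  fix a b assume "p dvd f * a + g * b"
  then have "p ^ Suc k dvd p ^ k * (f * a + g * b)"
    by simp
  then have "p ^ Suc k dvd f * (p ^ k * a) + g * (p ^ k * b)"
    by (simp only: distrib_left mult.left_commute)
  with ex obtain c where c: "p ^ Suc k dvd p ^ k * a - g * c" "p ^ Suc k dvd p ^ k * b + f * c"
    by (rule koszul_exactD)
  from c(2) have "p ^ k dvd p ^ k * b + f * c"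
    by (metis dvd_mult_right power_Suc)
  then have "p ^ k dvd f * c"
    by (simp add: dvd_add_right_iff)
  with p f have "p ^ k dvd c"
    by (rule prime_elem_power_dvd_multD)
  then obtain c' where c': "c = p ^ k * c'" ..
  have "p ^ k * p dvd p ^ k * (a - g * c')" "p ^ k * p dvd p ^ k * (b + f * c')"
    using c by (simp_all add: c' algebra_simps)
  with p have "p dvd a - g * c'" "p dvd b + f * c'"
    by (simp_all only: dvd_mult_cancel_left) auto
  then show "\<exists>c. p dvd a - g * c \<and> p dvd b + f * c"
    by blast
qed

lemma koszul_exact_prime_powerD:
  fixes p :: "'a::idom"
  assumes p: "prime_elem p" and ex: "koszul_exact (p ^ Suc k) f g"
  shows "koszul_exact p f g"
proof -
  note ex' = koszul_exact_swap[OF ex]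
  \<comment> \<open>The exponents of \<open>p\<close> in \<open>f\<close> and \<open>g\<close>,
    truncated at \<open>Suc k\<close>, are compared. The element with the smaller exponent turns out
    not to be divisible by \<open>p\<close>.\<close>
  have *: "\<not> p dvd f \<or> \<not> p dvd g"
  proof (rule power_dvd_or_exact_power[of p "Suc k" f];
         rule power_dvd_or_exact_power[of p "Suc k" g])
    \<comment> \<open>Here \<open>f\<close> and \<open>g\<close> vanish modulo
      \<open>p ^ Suc k\<close>: the pair \<open>(1, 0)\<close> is in the kernel but the image is
      zero, which would make \<open>p\<close> a unit.\<close>
    assume "p ^ Suc k dvd f" "p ^ Suc k dvd g"
    then have "p ^ Suc k dvd f * 1 + g * 0"
      by simp
    with ex obtain c where "p ^ Suc k dvd 1 - g * c"
      by (rule koszul_exactD)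
    moreover have "p ^ Suc k dvd g * c"
      using \<open>p ^ Suc k dvd g\<close> by (rule dvd_mult2)
    ultimately have "p ^ Suc k dvd 1 - g * c + g * c"
      by (rule dvd_add)
    then have "p dvd 1"
      by (simp only: diff_add_cancel power_Suc) (rule dvd_mult_left)
    with p show ?thesis
      by (simp add: prime_elem_def)
  next
    fix r f' assume "p ^ Suc k dvd g" and *: "r < Suc k" "f = p ^ r * f'" "\<not> p dvd f'"
    then have "p ^ r dvd g"
      by (meson less_imp_le power_le_dvd)
    then show ?thesis
      using koszul_exact_prime_power_not_dvd[OF p ex] * by blast
  next
    fix r g' assume "p ^ Suc k dvd f" and *: "r < Suc k" "g = p ^ r * g'" "\<not> p dvd g'"
    then have "p ^ r dvd f"
      by (meson less_imp_le power_le_dvd)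
    then show ?thesis
      using koszul_exact_prime_power_not_dvd[OF p ex'] * by blast
  next
    fix r f' s g'
    assume f: "r < Suc k" "f = p ^ r * f'" "\<not> p dvd f'"
      and g: "s < Suc k" "g = p ^ s * g'" "\<not> p dvd g'"
    show ?thesis
    proof (cases "r \<le> s")
      case True
      then have "p ^ r dvd g"
        unfolding g(2) by (intro dvd_mult2 le_imp_power_dvd)
      then show ?thesis
        using koszul_exact_prime_power_not_dvd[OF p ex] f by blast
    next
      case False
      then have "p ^ s dvd f"
        unfolding f(2) by (intro dvd_mult2 le_imp_power_dvd) simp
      then show ?thesis
        using koszul_exact_prime_power_not_dvd[OF p ex'] g by blast
    qed
  qed
  then show ?thesis
    using koszul_exact_prime_powerD_not_dvd[OF p ex] koszul_exact_prime_powerD_not_dvd[OF p ex']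
      koszul_exact_swap by blast
qed

section \<open>Prime factorization of the modulus\<close>

lemma koszul_exact_of_nat_iff:
  fixes f g :: "'a::idom"
  assumes prime: "\<And>p::nat. prime p \<Longrightarrow> prime_elem (of_nat p :: 'a)" and "N > 0"
  shows "koszul_exact (of_nat N) f g \<longleftrightarrow>
    (\<forall>p::nat. prime p \<and> p dvd N \<longrightarrow> koszul_exact (of_nat p) f g)"
proof (intro iffI allI impI)
  fix p :: nat assume ex: "koszul_exact (of_nat N) f g" and p: "prime p \<and> p dvd N"
  from \<open>N > 0\<close> p obtain k m where N: "N = p ^ k * m" and m: "\<not> p dvd m"
    using multiplicity_decompose'[of N p] by (metis neq0_conv not_prime_unit)
  have "k \<noteq> 0"
    using p N m by (metis mult_1 power_0)
  then obtain j where k: "k = Suc j"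
    using not0_implies_Suc by blast
  \<comment> \<open>A Bezout relation is found over the integers and carried into the ring by
    \<open>of_int\<close>.\<close>
  have "coprime (int (p ^ k)) (int m)"
    using p m by (simp add: prime_imp_coprime)
  then obtain s t where "s * int (p ^ k) + t * int m = 1"
    by (metis bezout_int coprime_iff_gcd_eq_1)
  then have "of_int s * of_nat p ^ k + of_int t * of_nat m = (1 :: 'a)"
    by (metis of_int_1 of_int_add of_int_mult of_int_of_nat_eq of_nat_power)
  moreover have "koszul_exact (of_nat p ^ k * of_nat m) f g"
    using ex N by simp
  ultimately have "koszul_exact (of_nat p ^ Suc j) f g"
    using koszul_exact_coprime_factor k by metis
  with prime p show "koszul_exact (of_nat p) f g"
    using koszul_exact_prime_powerD by blast
next
  assume "\<forall>p::nat. prime p \<and> p dvd N \<longrightarrow> koszul_exact (of_nat p) f g"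
  with \<open>N > 0\<close> show "koszul_exact (of_nat N) f g"
  proof (induction N rule: prime_divisors_induct)
    \<comment> \<open>Prime factors are split off one at a time, with multiplicity. Prime divisors
      of \<open>x\<close> also divide \<open>p * x\<close>, so the induction hypothesis covers the
      cofactor.\<close>
    case (factor p x)
    then have "koszul_exact (of_nat p) f g" "koszul_exact (of_nat x) f g"
      by auto
    moreover have "(of_nat p :: 'a) \<noteq> 0"
      using factor.hyps prime prime_elem_not_zeroI by blast
    ultimately show ?case
      by (simp add: koszul_exact_mult)
  qed (auto simp: koszul_exact_one)
qed

section \<open>Integral Laurent polynomials\<close>

text \<open>Compatibility of the lexicographic order with addition of exponents makes the integral
  Laurent polynomials an integral domain.\<close>

instance prod :: ("{ordered_cancel_comm_monoid_add, linorder}",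
    "{ordered_cancel_comm_monoid_add, linorder}") ordered_cancel_comm_monoid_add
  by standard (auto simp: less_eq_prod_def intro: add_strict_left_mono add_left_mono)

type_synonym int_laurent = "(int \<times> int) \<Rightarrow>\<^sub>0 int"

text \<open>Exponents form a group, so \<open>w = u + q\<close> has the single solution
  \<open>q = w - u\<close>. This brings the convolution into the shape of the product in
  \<open>laurent_ring\<close>.\<close>

lemma lookup_mult_keys:
  fixes a b :: "'k::ab_group_add \<Rightarrow>\<^sub>0 'b::semiring_0"
  shows "Poly_Mapping.lookup (a * b) w =
    (\<Sum>u\<in>Poly_Mapping.keys a. Poly_Mapping.lookup a u * Poly_Mapping.lookup b (w - u))"
proof -
  have "(\<Sum>q. Poly_Mapping.lookup b q when w = u + q) = Poly_Mapping.lookup b (w - u)" for u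
  proof -
    have "w = u + q \<longleftrightarrow> q = w - u" for q
      by (auto simp: algebra_simps)
    then show ?thesis by simp
  qed
  then have "Poly_Mapping.lookup (a * b) w =
      (\<Sum>u. Poly_Mapping.lookup a u * Poly_Mapping.lookup b (w - u))"
    by (simp add: times_poly_mapping.rep_eq prod_fun_def)
  also have "\<dots> = (\<Sum>u\<in>Poly_Mapping.keys a. Poly_Mapping.lookup a u * Poly_Mapping.lookup b (w - u))"
    by (rule Sum_any.expand_superset) (auto simp: in_keys_iff)
  finally show ?thesis .
qed

lemma lookup_of_nat_mult:
  fixes h :: "'k::monoid_add \<Rightarrow>\<^sub>0 'b::semiring_1"
  shows "Poly_Mapping.lookup (of_nat n * h) u = of_nat n * Poly_Mapping.lookup h u"
  by (induction n) (simp_all add: distrib_right lookup_add)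

lemma of_nat_dvd_poly_mapping_iff:
  fixes h :: "'k::comm_monoid_add \<Rightarrow>\<^sub>0 int"
  shows "of_nat n dvd h \<longleftrightarrow> (\<forall>u. int n dvd Poly_Mapping.lookup h u)"
proof
  assume "\<forall>u. int n dvd Poly_Mapping.lookup h u"
  then have "h = of_nat n * Poly_Mapping.map (\<lambda>c. c div int n) h"
    by (intro poly_mapping_eqI) (simp add: lookup_of_nat_mult map.rep_eq when_def)
  then show "of_nat n dvd h" by (rule dvdI)
qed (auto simp: lookup_of_nat_mult elim!: dvdE)

text \<open>A Gauss lemma argument: the lexicographically least terms of \<open>a\<close> and
  \<open>b\<close> that survive modulo \<open>p\<close> multiply to a term that survives in
  \<open>a * b\<close>.\<close>

lemma prime_elem_of_nat_int_laurent:
  assumes "prime (p::nat)"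
  shows "prime_elem (of_nat p :: int_laurent)"
proof (rule prime_elemI)
  show "(of_nat p :: int_laurent) \<noteq> 0"
    using assms by (simp add: prime_gt_0_nat)
  show "\<not> (of_nat p :: int_laurent) dvd 1"
    using assms by (auto simp: of_nat_dvd_poly_mapping_iff lookup_one
        zero_prod_def when_def)
next
  fix a b :: int_laurent
  define A where "A = (\<lambda>a :: int_laurent. {u. \<not> int p dvd Poly_Mapping.lookup a u})"
  have fin: "finite (A a)" for a
    by (rule finite_subset[of _ "Poly_Mapping.keys a"]) (auto simp: A_def in_keys_iff)
  assume ab: "of_nat p dvd a * b"
  show "of_nat p dvd a \<or> of_nat p dvd b"
  proof (rule ccontr)
    assume "\<not> ?thesis"
    then have ne: "A a \<noteq> {}" "A b \<noteq> {}"
      by (auto simp: of_nat_dvd_poly_mapping_iff A_def)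
    \<comment> \<open>Modulo \<open>p\<close>, only \<open>u\<close> and \<open>v\<close> contribute to the coefficient of \<open>a * b\<close> at \<open>u + v\<close>.\<close>
    define u v where "u = Min (A a)" and "v = Min (A b)"
    have uv: "u \<in> A a" "v \<in> A b"
      using Min_in fin ne by (auto simp: u_def v_def)
    have *: "int p dvd Poly_Mapping.lookup a w * Poly_Mapping.lookup b (u + v - w)"
      if "w \<noteq> u" for w
    proof (cases "w < u")
      case True
      then have "w \<notin> A a"
        using fin ne by (auto simp: u_def)
      then show ?thesis by (simp add: A_def)
    next
      case False
      \<comment> \<open>For \<open>w\<close> above \<open>u\<close>, translation invariance of the
        order puts \<open>u + v - w\<close> below the minimum \<open>v\<close> of
        \<open>A b\<close>.\<close>
      with that have "u + v - w < v"
        by (cases u; cases v; cases w) auto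
      then have "u + v - w \<notin> A b"
        using fin ne by (auto simp: v_def)
      then show ?thesis by (simp add: A_def)
    qed
    have u: "u \<in> Poly_Mapping.keys a"
      using uv by (auto simp: A_def in_keys_iff)
    have "int p dvd Poly_Mapping.lookup (a * b) (u + v)"
      using ab of_nat_dvd_poly_mapping_iff by blast
    also have "Poly_Mapping.lookup (a * b) (u + v) =
      Poly_Mapping.lookup a u * Poly_Mapping.lookup b v +
      (\<Sum>w\<in>Poly_Mapping.keys a - {u}. Poly_Mapping.lookup a w * Poly_Mapping.lookup b (u + v - w))"
      using u by (simp add: lookup_mult_keys sum.remove[of _ u])
    finally have "int p dvd Poly_Mapping.lookup a u * Poly_Mapping.lookup b v"
      using * by (subst (asm) dvd_add_left_iff) (auto intro!: dvd_sum)
    then show False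
      using uv assms by (auto simp: A_def prime_dvd_mult_iff)
  qed
qed

section \<open>Reduction of integral Laurent polynomials modulo \<open>n\<close>\<close>

lemma ring_hom_ring_ZMod: "ring_hom_ring \<Z> (ZFact k) (ZMod k)"
  unfolding ZMod_def ZFact_def
  by (rule ideal.rcos_ring_hom_ring) (simp add: int.genideal_ideal)

lemma ZMod_add: "ZMod k (a + b) = ZMod k a \<oplus>\<^bsub>ZFact k\<^esub> ZMod k b"
  using ring_hom_ring.homh[OF ring_hom_ring_ZMod] by (auto simp: ring_hom_def)

lemma ZMod_mult: "ZMod k (a * b) = ZMod k a \<otimes>\<^bsub>ZFact k\<^esub> ZMod k b"
  using ring_hom_ring.homh[OF ring_hom_ring_ZMod] by (auto simp: ring_hom_def)

lemma ZMod_closed [simp]: "ZMod k a \<in> carrier (ZFact k)"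
  using ring_hom_closed[OF ring_hom_ring.homh[OF ring_hom_ring_ZMod]] by simp

lemma ZMod_zero: "ZMod k 0 = \<zero>\<^bsub>ZFact k\<^esub>"
  using ring_hom_zero[OF ring_hom_ring.homh[OF ring_hom_ring_ZMod]]
  by (simp add: int.ring_axioms cring.axioms(1)[OF ZFact_is_cring])

lemma ZMod_surj:
  assumes "C \<in> carrier (ZFact k)"
  obtains a where "C = ZMod k a"
  using assms by (auto simp: ZFact_def FactRing_def A_RCOSETS_def' ZMod_def)

lemma ZMod_sum:
  assumes "finite A"
  shows "ZMod k (\<Sum>x\<in>A. h x) = (\<Oplus>\<^bsub>ZFact k\<^esub>x\<in>A. ZMod k (h x))"
proof -
  interpret Zk: cring "ZFact k" by (rule ZFact_is_cring)
  show ?thesis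
    using assms by induction (auto simp: ZMod_zero ZMod_add)
qed

text \<open>The additive structure suffices for the finite sums and signs in the matrices; products
  are transported from integral Laurent polynomials by \<open>laurent_mod_mult\<close>.\<close>

lemma abelian_group_laurent_ring:
  assumes "ring K"
  shows "abelian_group (laurent_ring K)"
proof -
  interpret ring K by fact
  show ?thesis
  proof (rule abelian_groupI)
    show "a \<oplus>\<^bsub>laurent_ring K\<^esub> b \<in> carrier (laurent_ring K)"
      if "a \<in> carrier (laurent_ring K)" "b \<in> carrier (laurent_ring K)" for a b
    proof -
      have "{u. a u \<oplus>\<^bsub>K\<^esub> b u \<noteq> \<zero>\<^bsub>K\<^esub>} \<subseteq> {u. a u \<noteq> \<zero>\<^bsub>K\<^esub>} \<union> {u. b u \<noteq> \<zero>\<^bsub>K\<^esub>}"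
        by auto
      with that show ?thesis
        by (auto simp: laurent_ring_def intro: finite_subset)
    qed
    show "\<exists>b\<in>carrier (laurent_ring K). b \<oplus>\<^bsub>laurent_ring K\<^esub> a = \<zero>\<^bsub>laurent_ring K\<^esub>"
      if a: "a \<in> carrier (laurent_ring K)" for a
    proof
      have "{u. \<ominus>\<^bsub>K\<^esub> a u \<noteq> \<zero>\<^bsub>K\<^esub>} \<subseteq> {u. a u \<noteq> \<zero>\<^bsub>K\<^esub>}"
        by auto
      with a show "(\<lambda>u. \<ominus>\<^bsub>K\<^esub> a u) \<in> carrier (laurent_ring K)"
        by (auto simp: laurent_ring_def intro: finite_subset)
      show "(\<lambda>u. \<ominus>\<^bsub>K\<^esub> a u) \<oplus>\<^bsub>laurent_ring K\<^esub> a = \<zero>\<^bsub>laurent_ring K\<^esub>"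
        using a by (auto simp: laurent_ring_def l_neg)
    qed
  qed (auto simp: laurent_ring_def fun_eq_iff a_ac simp del: split_paired_All)
qed

section \<open>Coefficientwise reduction\<close>

definition laurent_mod :: "nat \<Rightarrow> int_laurent \<Rightarrow> (int \<times> int \<Rightarrow> int set)" where
  "laurent_mod n h = (\<lambda>u. ZMod (int n) (Poly_Mapping.lookup h u))"

lemma laurent_mod_closed [simp]: "laurent_mod n h \<in> carrier (laurent_ring (ZFact (int n)))"
proof -
  have "{u. laurent_mod n h u \<noteq> \<zero>\<^bsub>ZFact (int n)\<^esub>} \<subseteq> Poly_Mapping.keys h"
    by (auto simp: laurent_mod_def in_keys_iff ZMod_zero)
  then have "finite {u. laurent_mod n h u \<noteq> \<zero>\<^bsub>ZFact (int n)\<^esub>}"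
    by (rule finite_subset) (rule finite_keys)
  then show ?thesis
    by (simp add: laurent_ring_def laurent_mod_def)
qed

lemma laurent_mod_surj:
  assumes "a \<in> carrier (laurent_ring (ZFact (int n)))"
  obtains h where "a = laurent_mod n h"
proof -
  \<comment> \<open>The zero class is always represented by 0, which keeps the support of the lift
    finite.\<close>
  have "\<exists>c. a u = ZMod (int n) c \<and> (a u = \<zero>\<^bsub>ZFact (int n)\<^esub> \<longrightarrow> c = 0)" for u
  proof (cases "a u = \<zero>\<^bsub>ZFact (int n)\<^esub>")
    case False
    have "a u \<in> carrier (ZFact (int n))"
      using assms by (simp add: laurent_ring_def del: split_paired_All)
    then obtain c where "a u = ZMod (int n) c" by (rule ZMod_surj)
    with False show ?thesis by blast
  qed (auto simp: ZMod_zero)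
  then obtain c where c: "\<And>u. a u = ZMod (int n) (c u)" "\<And>u. a u = \<zero>\<^bsub>ZFact (int n)\<^esub> \<Longrightarrow> c u = 0"
    by metis
  have "finite {u. a u \<noteq> \<zero>\<^bsub>ZFact (int n)\<^esub>}"
    using assms by (simp add: laurent_ring_def)
  then have "finite {u. c u \<noteq> 0}"
    by (rule rev_finite_subset) (use c(2) in blast)
  then have "a = laurent_mod n (Abs_poly_mapping c)"
    using c(1) by (simp add: laurent_mod_def fun_eq_iff)
  then show thesis by (rule that)
qed

lemma laurent_mod_zero: "\<zero>\<^bsub>laurent_ring (ZFact (int n))\<^esub> = laurent_mod n 0"
  by (simp add: laurent_ring_def laurent_mod_def ZMod_zero)

text \<open>The kernel of reduction consists of the multiples of \<open>n\<close>; this turns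
  equations over the residue ring into divisibility.\<close>

lemma laurent_mod_eq_iff: "laurent_mod n a = laurent_mod n b \<longleftrightarrow> of_nat n dvd a - b"
  by (simp only: laurent_mod_def fun_eq_iff ZMod_eq_mod of_nat_dvd_poly_mapping_iff
      lookup_minus mod_eq_dvd_iff)

lemma laurent_mod_add:
  "laurent_mod n a \<oplus>\<^bsub>laurent_ring (ZFact (int n))\<^esub> laurent_mod n b = laurent_mod n (a + b)"
  by (simp add: laurent_ring_def laurent_mod_def lookup_add ZMod_add)

lemma laurent_mod_uminus:
  "\<ominus>\<^bsub>laurent_ring (ZFact (int n))\<^esub> laurent_mod n a = laurent_mod n (- a)"
proof -
  interpret abelian_group "laurent_ring (ZFact (int n))"
    by (intro abelian_group_laurent_ring cring.axioms ZFact_is_cring)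
  show ?thesis
    by (rule minus_equality) (simp_all add: laurent_mod_add laurent_mod_zero)
qed

lemma laurent_mod_mult:
  "laurent_mod n a \<otimes>\<^bsub>laurent_ring (ZFact (int n))\<^esub> laurent_mod n b = laurent_mod n (a * b)"
proof
  fix w
  interpret Zn: cring "ZFact (int n)" by (rule ZFact_is_cring)
  have "(laurent_mod n a \<otimes>\<^bsub>laurent_ring (ZFact (int n))\<^esub> laurent_mod n b) w =
    (\<Oplus>\<^bsub>ZFact (int n)\<^esub>u\<in>{u. laurent_mod n a u \<noteq> \<zero>\<^bsub>ZFact (int n)\<^esub>}.
      laurent_mod n a u \<otimes>\<^bsub>ZFact (int n)\<^esub> laurent_mod n b (w - u))"
    by (simp add: laurent_ring_def)
  \<comment> \<open>Coefficients of \<open>a\<close> divisible by \<open>n\<close> vanish after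
    reduction, so the support may shrink; the terms added back are zero.\<close>
  also have "\<dots> = (\<Oplus>\<^bsub>ZFact (int n)\<^esub>u\<in>Poly_Mapping.keys a.
      laurent_mod n a u \<otimes>\<^bsub>ZFact (int n)\<^esub> laurent_mod n b (w - u))"
    by (rule Zn.add.finprod_mono_neutral_cong_left)
      (auto simp: laurent_mod_def in_keys_iff ZMod_zero)
  also have "\<dots> = laurent_mod n (a * b) w"
    by (simp add: laurent_mod_def lookup_mult_keys ZMod_sum ZMod_mult)
  finally show "(laurent_mod n a \<otimes>\<^bsub>laurent_ring (ZFact (int n))\<^esub> laurent_mod n b) w =
      laurent_mod n (a * b) w" .
qed

lemma laurent_reduce_laurent_mod:
  assumes "p dvd N"
  shows "laurent_reduce p (laurent_mod N h) = laurent_mod p h"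
  using assms by (simp add: laurent_reduce_def laurent_mod_def zmod_reduce_ZMod)

lemma laurent_bar_laurent_mod:
  "laurent_bar (laurent_mod n h) = laurent_mod n (Poly_Mapping.map_key uminus h)"
  by (simp add: laurent_bar_def laurent_mod_def map_key.rep_eq)

section \<open>The code complex\<close>

lemma vectors_laurent_mod:
  "vectors (laurent_ring (ZFact (int n))) k = map (laurent_mod n) ` {v. length v = k}"
proof (intro equalityI subsetI)
  fix v assume v: "v \<in> vectors (laurent_ring (ZFact (int n))) k"
  have "carrier (laurent_ring (ZFact (int n))) \<subseteq> range (laurent_mod n)"
    using laurent_mod_surj by blast
  with v have "v \<in> lists (range (laurent_mod n))"
    by (auto simp: vectors_def)
  then obtain w where "v = map (laurent_mod n) w"
    unfolding lists_image by blast
  with v show "v \<in> map (laurent_mod n) ` {v. length v = k}"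
    by (auto simp: vectors_def)
qed (auto simp: vectors_def)

lemma mat_apply_laurent_mod:
  assumes "\<And>row. row \<in> set A \<Longrightarrow> length row = length v"
  shows "mat_apply (laurent_ring (ZFact (int n))) (map (map (laurent_mod n)) A) (map (laurent_mod n) v)
    = map (\<lambda>row. laurent_mod n (\<Sum>j<length v. row ! j * v ! j)) A"
proof -
  interpret abelian_group "laurent_ring (ZFact (int n))"
    by (intro abelian_group_laurent_ring cring.axioms ZFact_is_cring)
  have "(\<Oplus>\<^bsub>laurent_ring (ZFact (int n))\<^esub>j\<in>{..<k}. laurent_mod n (h j)) = laurent_mod n (\<Sum>j<k. h j)"
    for h and k :: nat
    by (induction k) (simp_all add: lessThan_Suc laurent_mod_zero laurent_mod_add add.commute)
  moreover have "(\<Oplus>\<^bsub>laurent_ring (ZFact (int n))\<^esub>j\<in>{..<length v}.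
        map (laurent_mod n) row ! j \<otimes>\<^bsub>laurent_ring (ZFact (int n))\<^esub> map (laurent_mod n) v ! j) =
      (\<Oplus>\<^bsub>laurent_ring (ZFact (int n))\<^esub>j\<in>{..<length v}. laurent_mod n (row ! j * v ! j))"
    if "row \<in> set A" for row
    by (rule finsum_cong') (auto simp: laurent_mod_mult assms[OF that])
  ultimately show ?thesis
    by (simp add: mat_apply_def)
qed

text \<open>The complex splits into two Koszul complexes: the last two coordinates of a vector
  \<open>[a, b, c, d]\<close> belong to \<open>f\<close>, \<open>g\<close>, and the first two, read
  as the pair \<open>(b, -a)\<close>, to the conjugates.\<close>

lemma bb_topological_laurent_mod:
  fixes f g :: int_laurent
  defines "f' \<equiv> Poly_Mapping.map_key uminus f" and "g' \<equiv> Poly_Mapping.map_key uminus g"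
  shows "bb_topological (ZFact (int n)) (laurent_mod n f) (laurent_mod n g) \<longleftrightarrow>
    koszul_exact (of_nat n) f g \<and> koszul_exact (of_nat n) f' g'"
proof -
  define \<phi> where "\<phi> = laurent_mod n"
  define R where "R = laurent_ring (ZFact (int n))"
  have \<phi>_eq: "\<phi> a = \<phi> b \<longleftrightarrow> of_nat n dvd a - b" for a b
    by (simp add: \<phi>_def laurent_mod_eq_iff)
  have syn: "bb_syndrome (ZFact (int n)) (\<phi> f) (\<phi> g) = map (map \<phi>) [[0, 0, f, g], [- g', f', 0, 0]]"
    by (simp add: bb_syndrome_def Let_def \<phi>_def laurent_bar_laurent_mod laurent_mod_zero
        laurent_mod_uminus f'_def g'_def)
  have bd: "bb_boundary (ZFact (int n)) (\<phi> f) (\<phi> g) = map (map \<phi>) [[f', 0], [g', 0], [0, g], [0, - f]]"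
    by (simp add: bb_boundary_def Let_def \<phi>_def laurent_bar_laurent_mod laurent_mod_zero
        laurent_mod_uminus f'_def g'_def)
  have syn_apply: "mat_apply R (bb_syndrome (ZFact (int n)) (\<phi> f) (\<phi> g)) (map \<phi> [a, b, c, d]) =
      [\<phi> (f * c + g * d), \<phi> (f' * b - g' * a)]" for a b c d
    unfolding syn R_def unfolding \<phi>_def
    by (subst mat_apply_laurent_mod) (auto simp: numeral_eq_Suc lessThan_Suc algebra_simps)
  have bd_apply: "mat_apply R (bb_boundary (ZFact (int n)) (\<phi> f) (\<phi> g)) (map \<phi> [s, t]) =
      [\<phi> (f' * s), \<phi> (g' * s), \<phi> (g * t), \<phi> (- (f * t))]" for s t
    unfolding bd R_def unfolding \<phi>_def
    by (subst mat_apply_laurent_mod) (auto simp: numeral_eq_Suc lessThan_Suc algebra_simps)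
  have vec2: "vectors R 2 = {map \<phi> [s, t] | s t. True}"
  proof -
    have *: "{v. length v = 2} = {[s, t] | s t :: int_laurent. True}"
      by (auto simp: numeral_eq_Suc length_Suc_conv)
    show ?thesis
      unfolding R_def \<phi>_def vectors_laurent_mod * by blast
  qed
  have vec4: "vectors R 4 = {map \<phi> [a, b, c, d] | a b c d. True}"
  proof -
    have *: "{v. length v = 4} = {[a, b, c, d] | a b c d :: int_laurent. True}"
      by (auto simp: numeral_eq_Suc length_Suc_conv)
    show ?thesis
      unfolding R_def \<phi>_def vectors_laurent_mod * by blast
  qed
  define Ker where "Ker =
    {v \<in> vectors R 4. mat_apply R (bb_syndrome (ZFact (int n)) (\<phi> f) (\<phi> g)) v = [\<zero>\<^bsub>R\<^esub>, \<zero>\<^bsub>R\<^esub>]}"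
  define Im where "Im = mat_apply R (bb_boundary (ZFact (int n)) (\<phi> f) (\<phi> g)) ` vectors R 2"
  have mem_Ker: "map \<phi> [a, b, c, d] \<in> Ker \<longleftrightarrow>
      of_nat n dvd f * c + g * d \<and> of_nat n dvd f' * b - g' * a" for a b c d
  proof -
    have "map \<phi> [a, b, c, d] \<in> vectors R 4"
      unfolding vec4 by blast
    then show ?thesis
      by (simp only: Ker_def mem_Collect_eq syn_apply)
        (simp add: R_def laurent_mod_zero \<phi>_eq flip: \<phi>_def)
  qed
  have mem_Im: "map \<phi> [a, b, c, d] \<in> Im \<longleftrightarrow>
      (\<exists>s t. of_nat n dvd a - f' * s \<and> of_nat n dvd b - g' * s \<and>
        of_nat n dvd c - g * t \<and> of_nat n dvd d + f * t)" for a b c d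
  proof -
    have "Im = {[\<phi> (f' * s), \<phi> (g' * s), \<phi> (g * t), \<phi> (- (f * t))] | s t. True}"
      unfolding Im_def vec2 bd_apply[symmetric] by blast
    then show ?thesis
      by (simp add: \<phi>_eq)
  qed
  \<comment> \<open>The composite of the two maps is zero, so only the inclusion of the kernel in
    the image carries content.\<close>
  have "Im \<subseteq> Ker"
  proof
    fix v assume "v \<in> Im"
    then obtain s t where "v = map \<phi> [f' * s, g' * s, g * t, - (f * t)]"
      unfolding Im_def vec2 by (auto simp: bd_apply[simplified])
    then show "v \<in> Ker"
      by (simp only: mem_Ker) (simp add: algebra_simps)
  qed
  then have "bb_topological (ZFact (int n)) (\<phi> f) (\<phi> g) \<longleftrightarrow> Ker \<subseteq> Im"
    by (auto simp: bb_topological_def Let_def Ker_def Im_def R_def)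
  also have "\<dots> \<longleftrightarrow> (\<forall>a b c d. map \<phi> [a, b, c, d] \<in> Ker \<longrightarrow> map \<phi> [a, b, c, d] \<in> Im)"
    unfolding Ker_def vec4 by blast
  also have "\<dots> \<longleftrightarrow> koszul_exact (of_nat n) f g \<and> koszul_exact (of_nat n) f' g'"
    unfolding mem_Ker mem_Im
  proof (intro iffI conjI allI impI)
    assume *: "\<forall>a b c d. of_nat n dvd f * c + g * d \<and> of_nat n dvd f' * b - g' * a \<longrightarrow>
      (\<exists>s t. of_nat n dvd a - f' * s \<and> of_nat n dvd b - g' * s \<and>
        of_nat n dvd c - g * t \<and> of_nat n dvd d + f * t)"
    show "koszul_exact (of_nat n) f g"
      unfolding koszul_exact_def using *[rule_format, where a=0 and b=0] by auto
    show "koszul_exact (of_nat n) f' g'"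
      unfolding koszul_exact_def
    proof (intro allI impI)
      fix a b assume "of_nat n dvd f' * a + g' * b"
      \<comment> \<open>The pair \<open>(a, b)\<close> enters as the vector
        \<open>[- b, a, 0, 0]\<close>, which matches the signs in the second row of the syndrome
        matrix.\<close>
      then obtain s where "of_nat n dvd - b - f' * s" "of_nat n dvd a - g' * s"
        using *[rule_format, where a="- b" and b=a and c=0 and d=0] by auto
      moreover have "- b - f' * s = - (b + f' * s)"
        by simp
      ultimately show "\<exists>c. of_nat n dvd a - g' * c \<and> of_nat n dvd b + f' * c"
        by (metis dvd_minus_iff)
    qed
  next
    fix a b c d
    assume E: "koszul_exact (of_nat n) f g \<and> koszul_exact (of_nat n) f' g'"
      and K: "of_nat n dvd f * c + g * d \<and> of_nat n dvd f' * b - g' * a"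
    then obtain t where t: "of_nat n dvd c - g * t" "of_nat n dvd d + f * t"
      by (blast elim: koszul_exactD)
    from K have "of_nat n dvd f' * b + g' * (- a)"
      by simp
    then obtain s where "of_nat n dvd b - g' * s" "of_nat n dvd - a + f' * s"
      using E by (blast elim: koszul_exactD)
    moreover have "- a + f' * s = - (a - f' * s)"
      by simp
    ultimately show "\<exists>s t. of_nat n dvd a - f' * s \<and> of_nat n dvd b - g' * s \<and>
        of_nat n dvd c - g * t \<and> of_nat n dvd d + f * t"
      using t by (metis dvd_minus_iff)
  qed
  finally show ?thesis
    by (simp add: \<phi>_def)
qed

theorem theorem1:
  fixes N :: nat and f g :: "int \<times> int \<Rightarrow> int set"
  assumes "N > 0"
    and "f \<in> carrier (laurent_ring (ZFact (int N)))"
    and "g \<in> carrier (laurent_ring (ZFact (int N)))"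
  shows "bb_topological (ZFact (int N)) f g \<longleftrightarrow>
    (\<forall>p::nat. prime p \<and> p dvd N \<longrightarrow>
      bb_topological (ZFact (int p)) (laurent_reduce p f) (laurent_reduce p g))"
proof -
  \<comment> \<open>One integral lift serves \<open>N\<close> and all its prime divisors, since
    reduction modulo \<open>p\<close> factors through reduction modulo \<open>N\<close>. The
    criterion is then used both for \<open>F\<close>, \<open>G\<close> and for their
    conjugates.\<close>
  obtain F G where FG: "f = laurent_mod N F" "g = laurent_mod N G"
    using assms laurent_mod_surj by metis
  show ?thesis
    unfolding FG using koszul_exact_of_nat_iff[OF prime_elem_of_nat_int_laurent \<open>N > 0\<close>]
    by (auto simp: bb_topological_laurent_mod laurent_reduce_laurent_mod)
qed

end
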